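(* Let $(A,\mu,\alpha,\beta)$ be a BiHom-alternative algebra and let $V_{\phi,\psi}=(V,\phi,\psi)$ be a BiHom-alternative $A$-bimodule with structure maps $\rho_l$ and $\rho_r$. Then for each $n,m\in\mathbb{N}$ the maps $$\rho_l^{(n,m)}=\rho_l\circ(\alpha^n\beta^m\otimes \mathrm{Id}_V),\qquad \rho_r^{(n,m)}=\rho_r\circ(\mathrm{Id}_V\otimes\alpha^n\beta^m)$$ give the BiHom-module $(V,\phi,\psi)$ the structure of a BiHom-alternative $A$-bimodule.
   Context: $\mathbb{K}$ is an algebraically closed field of characteristic $0$; all vector spaces and (multi)linear maps are over $\mathbb{K}$. A BiHom-algebra $(A,\mu,\alpha,\beta)$ is a vector space $A$ with a bilinear map $\mu:A\times A\to A$ and linear maps $\alpha,\beta:A\to A$ with $\alpha\beta=\beta\alpha$. It is multiplicative if $\alpha(\mu(x,y))=\mu(\alpha(x),\alpha(y))$ and $\beta(\mu(x,y))=\mu(\beta(x),\beta(y))$ for all $x,y\in A$. Its BiHom-associator is $as_{\alpha,\beta}(x,y,z)=\mu(\mu(x,y),\beta(z))-\mu(\alpha(x),\mu(y,z))$. A BiHom-alternative algebra is a multiplicative BiHom-algebra satisfying, for all $x,y,z\in A$, $as_{\alpha,\beta}(\beta(x),\alpha(y),z)+as_{\alpha,\beta}(\beta(y),\alpha(x),z)=0$ and $as_{\alpha,\beta}(x,\beta(y),\alpha(z))+as_{\alpha,\beta}(x,\beta(z),\alpha(y))=0$. A BiHom-module $(V,\phi,\psi)$ is a vector space $V$ with linear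 maps $\phi,\psi:V\to V$, $\phi\psi=\psi\phi$. For a BiHom-algebra $(A,\mu,\alpha,\beta)$, left and right structure maps on $V$ are linear maps $\rho_l:A\otimes V\to V$ and $\rho_r:V\otimes A\to V$ with $\phi\rho_l=\rho_l(\alpha\otimes\phi)$, $\psi\rho_l=\rho_l(\beta\otimes\psi)$, $\phi\rho_r=\rho_r(\phi\otimes\alpha)$, $\psi\rho_r=\rho_r(\psi\otimes\beta)$. The module BiHom-associator $as_V=as_{V_{\phi,\psi}}$ is, for $x,y\in A$, $v\in V$: $as_V(v,x,y)=\rho_r(\rho_r(v,x),\beta(y))-\rho_r(\phi(v),\mu(x,y))$, $as_V(x,v,y)=\rho_r(\rho_l(x,v),\beta(y))-\rho_l(\alpha(x),\rho_r(v,y))$, $as_V(x,y,v)=\rho_l(\mu(x,y),\psi(v))-\rho_l(\alpha(x),\rho_l(y,v))$. A BiHom-alternative $A$-bimodule ($A$ BiHom-alternative) is a BiHom-module $(V,\phi,\psi)$ with left and right structure maps $\rho_l,\rho_r$ such that for all $x,y\in A$, $v\in V$: $as_V(\beta(x),\alpha(x),v)=0$; $as_V(v,\beta(x),\alpha(x))=0$; $as_V(\beta(x),\phi(v),y)=-as_V(\psi(v),\alpha(x),y)$; $as_V(y,\beta(x),\phi(v))=-as_V(y,\psi(v),\alpha(x))$. *)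

theory Defs
  imports "HOL-Computational_Algebra.Polynomial"
begin

text \<open>
  Vector spaces are carried by whole types, with an explicit scalar multiplication, as in
  \<^locale>\<open>vector_space\<close>. Linear maps out of a tensor product are represented by the
  corresponding curried bilinear maps; a condition such as
  \<open>\<phi> \<circ> \<rho>\<^sub>l = \<rho>\<^sub>l \<circ> (\<alpha> \<otimes> \<phi>)\<close> is
  then stated on pure tensors.
\<close>

definition bilinear_map ::
  "('k::field \<Rightarrow> 'a::ab_group_add \<Rightarrow> 'a) \<Rightarrow> ('k \<Rightarrow> 'b::ab_group_add \<Rightarrow> 'b) \<Rightarrow>
   ('k \<Rightarrow> 'c::ab_group_add \<Rightarrow> 'c) \<Rightarrow> ('a \<Rightarrow> 'b \<Rightarrow> 'c) \<Rightarrow> bool"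
  where "bilinear_map s1 s2 s3 f \<longleftrightarrow>
    (\<forall>x. Vector_Spaces.linear s2 s3 (\<lambda>y. f x y)) \<and>
    (\<forall>y. Vector_Spaces.linear s1 s3 (\<lambda>x. f x y))"

locale bihom_algebra =
  vector_space scaleA
  for scaleA :: "'k::field \<Rightarrow> 'a::ab_group_add \<Rightarrow> 'a" +
  fixes \<mu> :: "'a \<Rightarrow> 'a \<Rightarrow> 'a" and \<alpha> \<beta> :: "'a \<Rightarrow> 'a"
  assumes bilinear_mu: "bilinear_map scaleA scaleA scaleA \<mu>"
    and linear_alpha: "Vector_Spaces.linear scaleA scaleA \<alpha>"
    and linear_beta: "Vector_Spaces.linear scaleA scaleA \<beta>"
    and alpha_beta_commute: "\<alpha> \<circ> \<beta> = \<beta> \<circ> \<alpha>"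
begin

definition as :: "'a \<Rightarrow> 'a \<Rightarrow> 'a \<Rightarrow> 'a"
  where "as x y z = \<mu> (\<mu> x y) (\<beta> z) - \<mu> (\<alpha> x) (\<mu> y z)"

end

locale multiplicative_bihom_algebra = bihom_algebra +
  assumes alpha_mult: "\<alpha> (\<mu> x y) = \<mu> (\<alpha> x) (\<alpha> y)"
    and beta_mult: "\<beta> (\<mu> x y) = \<mu> (\<beta> x) (\<beta> y)"

locale bihom_alternative_algebra = multiplicative_bihom_algebra +
  assumes left_alternative: "as (\<beta> x) (\<alpha> y) z + as (\<beta> y) (\<alpha> x) z = 0"
    and right_alternative: "as x (\<beta> y) (\<alpha> z) + as x (\<beta> z) (\<alpha> y) = 0"

locale bihom_module =
  vector_space scaleV
  for scaleV :: "'k::field \<Rightarrow> 'v::ab_group_add \<Rightarrow> 'v" +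
  fixes \<phi> \<psi> :: "'v \<Rightarrow> 'v"
  assumes linear_phi: "Vector_Spaces.linear scaleV scaleV \<phi>"
    and linear_psi: "Vector_Spaces.linear scaleV scaleV \<psi>"
    and phi_psi_commute: "\<phi> \<circ> \<psi> = \<psi> \<circ> \<phi>"

locale bihom_structure_maps =
  A: bihom_algebra scaleA \<mu> \<alpha> \<beta> + V: bihom_module scaleV \<phi> \<psi>
  for scaleA :: "'k::field \<Rightarrow> 'a::ab_group_add \<Rightarrow> 'a"
    and \<mu> :: "'a \<Rightarrow> 'a \<Rightarrow> 'a" and \<alpha> \<beta> :: "'a \<Rightarrow> 'a"
    and scaleV :: "'k \<Rightarrow> 'v::ab_group_add \<Rightarrow> 'v" and \<phi> \<psi> :: "'v \<Rightarrow> 'v" +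
  fixes \<rho>\<^sub>l :: "'a \<Rightarrow> 'v \<Rightarrow> 'v" and \<rho>\<^sub>r :: "'v \<Rightarrow> 'a \<Rightarrow> 'v"
  assumes bilinear_rho_l: "bilinear_map scaleA scaleV scaleV \<rho>\<^sub>l"
    and bilinear_rho_r: "bilinear_map scaleV scaleA scaleV \<rho>\<^sub>r"
    and phi_rho_l: "\<phi> (\<rho>\<^sub>l x v) = \<rho>\<^sub>l (\<alpha> x) (\<phi> v)"
    and psi_rho_l: "\<psi> (\<rho>\<^sub>l x v) = \<rho>\<^sub>l (\<beta> x) (\<psi> v)"
    and phi_rho_r: "\<phi> (\<rho>\<^sub>r v x) = \<rho>\<^sub>r (\<phi> v) (\<alpha> x)"
    and psi_rho_r: "\<psi> (\<rho>\<^sub>r v x) = \<rho>\<^sub>r (\<psi> v) (\<beta> x)"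
begin

text \<open>
  The module BiHom-associator \<open>as\<^sub>V\<close> is one function for each position of the module
  argument.
\<close>

definition as_VAA :: "'v \<Rightarrow> 'a \<Rightarrow> 'a \<Rightarrow> 'v"
  where "as_VAA v x y = \<rho>\<^sub>r (\<rho>\<^sub>r v x) (\<beta> y) - \<rho>\<^sub>r (\<phi> v) (\<mu> x y)"

definition as_AVA :: "'a \<Rightarrow> 'v \<Rightarrow> 'a \<Rightarrow> 'v"
  where "as_AVA x v y = \<rho>\<^sub>r (\<rho>\<^sub>l x v) (\<beta> y) - \<rho>\<^sub>l (\<alpha> x) (\<rho>\<^sub>r v y)"

definition as_AAV :: "'a \<Rightarrow> 'a \<Rightarrow> 'v \<Rightarrow> 'v"
  where "as_AAV x y v = \<rho>\<^sub>l (\<mu> x y) (\<psi> v) - \<rho>\<^sub>l (\<alpha> x) (\<rho>\<^sub>l y v)"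

end

locale bihom_alternative_bimodule =
  bihom_structure_maps scaleA \<mu> \<alpha> \<beta> scaleV \<phi> \<psi> \<rho>\<^sub>l \<rho>\<^sub>r +
  A: bihom_alternative_algebra scaleA \<mu> \<alpha> \<beta>
  for scaleA :: "'k::field \<Rightarrow> 'a::ab_group_add \<Rightarrow> 'a"
    and \<mu> :: "'a \<Rightarrow> 'a \<Rightarrow> 'a" and \<alpha> \<beta> :: "'a \<Rightarrow> 'a"
    and scaleV :: "'k \<Rightarrow> 'v::ab_group_add \<Rightarrow> 'v" and \<phi> \<psi> :: "'v \<Rightarrow> 'v"
    and \<rho>\<^sub>l :: "'a \<Rightarrow> 'v \<Rightarrow> 'v" and \<rho>\<^sub>r :: "'v \<Rightarrow> 'a \<Rightarrow> 'v" +
  assumes as_AAV_alternating: "as_AAV (\<beta> x) (\<alpha> x) v = 0"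
    and as_VAA_alternating: "as_VAA v (\<beta> x) (\<alpha> x) = 0"
    and as_AVA_VAA: "as_AVA (\<beta> x) (\<phi> v) y = - as_VAA (\<psi> v) (\<alpha> x) y"
    and as_AAV_AVA: "as_AAV y (\<beta> x) (\<phi> v) = - as_AVA y (\<psi> v) (\<alpha> x)"

end

theory Submission
  imports Defs
begin

text \<open>
  The map \<open>\<gamma> = \<alpha>\<^sup>n \<beta>\<^sup>m\<close> is an endomorphism of \<open>A\<close> commuting
  with \<open>\<alpha>\<close> and \<open>\<beta>\<close>. Precomposing the algebra argument of both actions with such a
  \<open>\<gamma>\<close> turns every module associator into the original one with \<open>\<gamma>\<close> applied to its two
  algebra arguments, so each bimodule identity is an instance of the old one.
\<close>

lemma linear_funpow:
  assumes "Vector_Spaces.linear s s f"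
  shows "Vector_Spaces.linear s s (f ^^ n)"
proof (induction n)
  case 0
  \<comment> \<open>The identity is linear only once \<open>s\<close> is known to be a vector space;
    this is contained in the linearity of \<open>f\<close>.\<close>
  interpret Vector_Spaces.linear s s f by fact
  show ?case using vs1.linear_id by (simp add: id_def)
next
  case (Suc n)
  then show ?case
    using assms unfolding funpow.simps by (rule Vector_Spaces.linear_compose)
qed

text \<open>In the slot of \<open>g\<close> linear maps are composed; in the other slot linearity is
  that of \<open>f\<close> at the fixed argument \<open>g x\<close>.\<close>

lemma bilinear_map_precompose_left:
  assumes "bilinear_map s1 s2 s3 f" and "Vector_Spaces.linear s s1 g"
  shows "bilinear_map s s2 s3 (\<lambda>x. f (g x))"
  using assms(1) Vector_Spaces.linear_compose[OF assms(2), of s3]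
  unfolding bilinear_map_def o_def by blast

lemma bilinear_map_precompose_right:
  assumes "bilinear_map s1 s2 s3 f" and "Vector_Spaces.linear s s2 g"
  shows "bilinear_map s1 s s3 (\<lambda>x y. f x (g y))"
  using assms(1) Vector_Spaces.linear_compose[OF assms(2), of s3]
  unfolding bilinear_map_def o_def by blast

text \<open>Compatibility survives because, for instance, \<open>\<phi> (\<rho>\<^sub>l (\<gamma> x)
  v) = \<rho>\<^sub>l (\<alpha> (\<gamma> x)) (\<phi> v)\<close> and
  \<open>\<alpha> (\<gamma> x) = \<gamma> (\<alpha> x)\<close>. This makes the associators of the
  twisted actions available.\<close>

lemma (in bihom_structure_maps) structure_maps_twist:
  assumes lin: "Vector_Spaces.linear scaleA scaleA \<gamma>"
    and \<alpha>: "\<And>x. \<gamma> (\<alpha> x) = \<alpha> (\<gamma> x)"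
    and \<beta>: "\<And>x. \<gamma> (\<beta> x) = \<beta> (\<gamma> x)"
  shows "bihom_structure_maps scaleA \<mu> \<alpha> \<beta> scaleV \<phi> \<psi>
           (\<lambda>x v. \<rho>\<^sub>l (\<gamma> x) v) (\<lambda>v x. \<rho>\<^sub>r v (\<gamma> x))"
  using bilinear_map_precompose_left[OF bilinear_rho_l lin]
    bilinear_map_precompose_right[OF bilinear_rho_r lin]
  by unfold_locales (simp_all add: \<alpha> \<beta> phi_rho_l psi_rho_l phi_rho_r psi_rho_r)

lemma (in bihom_alternative_bimodule) bimodule_twist:
  assumes lin: "Vector_Spaces.linear scaleA scaleA \<gamma>"
    and \<mu>: "\<And>x y. \<gamma> (\<mu> x y) = \<mu> (\<gamma> x) (\<gamma> y)"
    and \<alpha>: "\<And>x. \<gamma> (\<alpha> x) = \<alpha> (\<gamma> x)"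
    and \<beta>: "\<And>x. \<gamma> (\<beta> x) = \<beta> (\<gamma> x)"
  shows "bihom_alternative_bimodule scaleA \<mu> \<alpha> \<beta> scaleV \<phi> \<psi>
           (\<lambda>x v. \<rho>\<^sub>l (\<gamma> x) v) (\<lambda>v x. \<rho>\<^sub>r v (\<gamma> x))"
proof -
  interpret T: bihom_structure_maps scaleA \<mu> \<alpha> \<beta> scaleV \<phi> \<psi>
    "\<lambda>x v. \<rho>\<^sub>l (\<gamma> x) v" "\<lambda>v x. \<rho>\<^sub>r v (\<gamma> x)"
    using lin \<alpha> \<beta> by (rule structure_maps_twist)
  \<comment> \<open>Multiplicativity of \<open>\<gamma>\<close> treats the terms containing
    \<open>\<mu> x y\<close>; commutation treats the factors \<open>\<alpha> x\<close> and
    \<open>\<beta> y\<close>.\<close>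
  have as_twist: "T.as_VAA v x y = as_VAA v (\<gamma> x) (\<gamma> y)"
    "T.as_AVA x v y = as_AVA (\<gamma> x) v (\<gamma> y)"
    "T.as_AAV x y v = as_AAV (\<gamma> x) (\<gamma> y) v" for x y v
    by (simp_all add: T.as_VAA_def T.as_AVA_def T.as_AAV_def
        as_VAA_def as_AVA_def as_AAV_def \<mu> \<alpha> \<beta>)
  show ?thesis
    \<comment> \<open>After \<open>\<gamma>\<close> is moved inside \<open>\<alpha>\<close> and
      \<open>\<beta>\<close>, each identity is the old one at \<open>\<gamma> x\<close> and
      \<open>\<gamma> y\<close>.\<close>
    by unfold_locales
      (simp_all add: as_twist \<alpha> \<beta> as_AAV_alternating as_VAA_alternating as_AVA_VAA as_AAV_AVA)
qed

theorem proposition4p8: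
  fixes scaleA :: "'k::{alg_closed_field, field_char_0} \<Rightarrow> 'a::ab_group_add \<Rightarrow> 'a"
    and \<mu> :: "'a \<Rightarrow> 'a \<Rightarrow> 'a" and \<alpha> \<beta> :: "'a \<Rightarrow> 'a"
    and scaleV :: "'k \<Rightarrow> 'v::ab_group_add \<Rightarrow> 'v" and \<phi> \<psi> :: "'v \<Rightarrow> 'v"
    and \<rho>\<^sub>l :: "'a \<Rightarrow> 'v \<Rightarrow> 'v" and \<rho>\<^sub>r :: "'v \<Rightarrow> 'a \<Rightarrow> 'v"
    and n m :: nat
  assumes "bihom_alternative_algebra scaleA \<mu> \<alpha> \<beta>"
    and "bihom_alternative_bimodule scaleA \<mu> \<alpha> \<beta> scaleV \<phi> \<psi> \<rho>\<^sub>l \<rho>\<^sub>r"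
  shows "bihom_alternative_bimodule scaleA \<mu> \<alpha> \<beta> scaleV \<phi> \<psi>
           (\<lambda>x v. \<rho>\<^sub>l ((\<alpha> ^^ n \<circ> \<beta> ^^ m) x) v)
           (\<lambda>v x. \<rho>\<^sub>r v ((\<alpha> ^^ n \<circ> \<beta> ^^ m) x))"
proof -
  interpret bihom_alternative_bimodule scaleA \<mu> \<alpha> \<beta> scaleV \<phi> \<psi> \<rho>\<^sub>l \<rho>\<^sub>r
    by fact
  have comm: "\<alpha> (\<beta> x) = \<beta> (\<alpha> x)" for x
    using A.alpha_beta_commute by (metis comp_apply)
  \<comment> \<open>The three conditions on \<open>\<gamma>\<close> are stable under composition, so
    they are checked for the powers of \<alpha> and of \<beta> separately.\<close>
  have \<alpha>_pow: "(\<alpha> ^^ n) (\<mu> x y) = \<mu> ((\<alpha> ^^ n) x) ((\<alpha> ^^ n) y)"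
    "(\<alpha> ^^ n) (\<alpha> x) = \<alpha> ((\<alpha> ^^ n) x)" "(\<alpha> ^^ n) (\<beta> x) = \<beta> ((\<alpha> ^^ n) x)" for x y
    by (induction n) (simp_all add: A.alpha_mult comm)
  have \<beta>_pow: "(\<beta> ^^ m) (\<mu> x y) = \<mu> ((\<beta> ^^ m) x) ((\<beta> ^^ m) y)"
    "(\<beta> ^^ m) (\<alpha> x) = \<alpha> ((\<beta> ^^ m) x)" "(\<beta> ^^ m) (\<beta> x) = \<beta> ((\<beta> ^^ m) x)" for x y
    by (induction m) (simp_all add: A.beta_mult comm)
  have "Vector_Spaces.linear scaleA scaleA (\<alpha> ^^ n \<circ> \<beta> ^^ m)"
    by (rule Vector_Spaces.linear_compose[OF linear_funpow linear_funpow])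
      (fact A.linear_beta A.linear_alpha)+
  then show ?thesis
    by (rule bimodule_twist) (simp_all add: \<alpha>_pow \<beta>_pow)
qed

end
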